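(* Let $n\ge 1$ and let $\ell$ be an integer with $(2n+4)/3 \leq \ell \leq n$. If $G$ and $G'$ are graphs on $n$ vertices with $\mathcal{D}_\ell(G)=\mathcal{D}_\ell(G')$, then $G$ is a tree if and only if $G'$ is a tree.
   Context: All graphs are finite, simple and undirected. For a graph $G$ and an integer $\ell$, the $\ell$-deck $\mathcal{D}_\ell(G)$ is the multiset of isomorphism classes of all induced subgraphs of $G$ on exactly $\ell$ vertices (one for each $\ell$-subset of $V(G)$). *)

theory Defs
  imports Complex_Main "HOL-Library.Multiset"
begin

record 'a ugraph =
  verts :: "'a set"
  edges :: "'a set set"

definition simple_graph :: "'a ugraph \<Rightarrow> bool" where
  "simple_graph G \<longleftrightarrow>
     finite (verts G) \<and> (\<forall>e\<in>edges G. e \<subseteq> verts G \<and> card e = 2)"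

definition adjacent :: "'a ugraph \<Rightarrow> 'a \<Rightarrow> 'a \<Rightarrow> bool" where
  "adjacent G u v \<longleftrightarrow> {u, v} \<in> edges G"

definition induced :: "'a ugraph \<Rightarrow> 'a set \<Rightarrow> 'a ugraph" where
  "induced G S = \<lparr>verts = S, edges = {e \<in> edges G. e \<subseteq> S}\<rparr>"

definition isomorphic :: "'a ugraph \<Rightarrow> 'b ugraph \<Rightarrow> bool" where
  "isomorphic G H \<longleftrightarrow>
     (\<exists>f. bij_betw f (verts G) (verts H) \<and>
        (\<forall>u\<in>verts G. \<forall>v\<in>verts G. adjacent G u v \<longleftrightarrow> adjacent H (f u) (f v)))"

(* The isomorphism class is taken among the graphs whose vertices lie in the type 'a.
   The decks compared below are those of graphs over one and the same vertex type,
   so that equality of classes is isomorphism of the graphs (iso_class_eq_iff). *)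
definition iso_class :: "'a ugraph \<Rightarrow> 'a ugraph set" where
  "iso_class G = {H. simple_graph H \<and> isomorphic G H}"

definition deck :: "nat \<Rightarrow> 'a ugraph \<Rightarrow> 'a ugraph set multiset" where
  "deck l G = image_mset (\<lambda>S. iso_class (induced G S))
                (mset_set {S. S \<subseteq> verts G \<and> card S = l})"

definition connected_graph :: "'a ugraph \<Rightarrow> bool" where
  "connected_graph G \<longleftrightarrow>
     verts G \<noteq> {} \<and> (\<forall>u\<in>verts G. \<forall>v\<in>verts G. (adjacent G)\<^sup>*\<^sup>* u v)"

(* A cycle is given by the list of its vertices, the first one not repeated at the end. *)
definition is_cycle :: "'a ugraph \<Rightarrow> 'a list \<Rightarrow> bool" where
  "is_cycle G p \<longleftrightarrow>
     length p \<ge> 3 \<and> distinct p \<and>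
     (\<forall>i<length p. adjacent G (p ! i) (p ! (Suc i mod length p)))"

definition is_tree :: "'a ugraph \<Rightarrow> bool" where
  "is_tree G \<longleftrightarrow> connected_graph G \<and> (\<nexists>p. is_cycle G p)"

lemma isomorphic_refl: "isomorphic G G"
  unfolding isomorphic_def by (rule exI[of _ id]) auto

lemma isomorphic_sym:
  assumes "isomorphic G H" shows "isomorphic H G"
proof -
  obtain f where f: "bij_betw f (verts G) (verts H)"
    and adj: "\<And>u v. u \<in> verts G \<Longrightarrow> v \<in> verts G \<Longrightarrow> adjacent G u v \<longleftrightarrow> adjacent H (f u) (f v)"
    using assms unfolding isomorphic_def by blast
  let ?g = "the_inv_into (verts G) f"
  have g: "bij_betw ?g (verts H) (verts G)"
    using f by (rule bij_betw_the_inv_into)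
  have "adjacent H u v \<longleftrightarrow> adjacent G (?g u) (?g v)" if "u \<in> verts H" "v \<in> verts H" for u v
    using adj[of "?g u" "?g v"] that f g
    by (simp add: f_the_inv_into_f_bij_betw bij_betwE)
  with g show ?thesis unfolding isomorphic_def by blast
qed

lemma isomorphic_trans:
  assumes "isomorphic G H" "isomorphic H K" shows "isomorphic G K"
proof -
  obtain f where f: "bij_betw f (verts G) (verts H)"
    and adjf: "\<And>u v. u \<in> verts G \<Longrightarrow> v \<in> verts G \<Longrightarrow> adjacent G u v \<longleftrightarrow> adjacent H (f u) (f v)"
    using assms(1) unfolding isomorphic_def by blast
  obtain g where g: "bij_betw g (verts H) (verts K)"
    and adjg: "\<And>u v. u \<in> verts H \<Longrightarrow> v \<in> verts H \<Longrightarrow> adjacent H u v \<longleftrightarrow> adjacent K (g u) (g v)"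
    using assms(2) unfolding isomorphic_def by blast
  have "bij_betw (g \<circ> f) (verts G) (verts K)"
    using f g by (rule bij_betw_trans)
  moreover have "adjacent G u v \<longleftrightarrow> adjacent K ((g \<circ> f) u) ((g \<circ> f) v)"
    if "u \<in> verts G" "v \<in> verts G" for u v
    using that adjf adjg bij_betwE[OF f] by simp
  ultimately show ?thesis unfolding isomorphic_def by blast
qed

lemma iso_class_eq_iff:
  assumes "simple_graph G" "simple_graph H"
  shows "iso_class G = iso_class H \<longleftrightarrow> isomorphic G H"
proof
  assume "iso_class G = iso_class H"
  moreover have "H \<in> iso_class H"
    using assms(2) isomorphic_refl by (simp add: iso_class_def)
  ultimately have "H \<in> iso_class G"
    by simp
  then show "isomorphic G H"
    by (simp add: iso_class_def)
next
  assume GH: "isomorphic G H"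
  have "isomorphic G K \<longleftrightarrow> isomorphic H K" for K :: "'a ugraph"
    using isomorphic_trans[OF GH, of K] isomorphic_trans[OF isomorphic_sym[OF GH], of K] by iprover
  then show "iso_class G = iso_class H"
    by (simp add: iso_class_def)
qed

end

(*
Let G be a tree and let G' have the same l-deck. Both graphs have equally many edges, so it suffices
to exclude cycles in G'. A cycle of G' is visible in a card unless its length k exceeds l; take one
and put r = floor((n - k) / 2) + 1. Call a vertex middle if two non-backtracking walks of length r
leave it along different edges. All k vertices of the cycle are middle in G', whereas in the forest
G the first r and the last r vertices of a longest path are not middle, which leaves at most
n - 2 r < k middle vertices.

The number of middle vertices is determined by the deck. Being middle depends only on the ball of
radius r around the vertex, so Moebius inversion over vertex subsets expresses this number through
the induced subgraphs on at most l vertices as soon as these balls have at most l vertices, and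
Kelly's lemma applies. In G' a ball meets the cycle in at most 2 r + 1 vertices, because an ear or a
chord of the cycle would create a cycle of length at most l; hence it has fewer than l vertices. A
ball with at least l vertices in G would yield a card of radius r, hence such a ball in G'.
*)

theory Submission
  imports Defs
begin

section \<open>Cards and weighted sums over induced subgraphs\<close>

lemma verts_induced [simp]: "verts (induced G S) = S"
  by (simp add: induced_def)

lemma adjacent_induced [simp]:
  "adjacent (induced G S) u v \<longleftrightarrow> adjacent G u v \<and> u \<in> S \<and> v \<in> S"
  by (auto simp: induced_def adjacent_def)

lemma induced_induced: "T \<subseteq> S \<Longrightarrow> induced (induced G S) T = induced G T"
  by (auto simp: induced_def)

lemma induced_verts: "simple_graph G \<Longrightarrow> induced G (verts G) = G"
  by (cases G) (auto simp: induced_def simple_graph_def)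

lemma simple_graph_finite: "simple_graph G \<Longrightarrow> finite (verts G)"
  by (simp add: simple_graph_def)

lemma simple_graph_induced:
  "simple_graph G \<Longrightarrow> S \<subseteq> verts G \<Longrightarrow> simple_graph (induced G S)"
  by (auto simp: simple_graph_def induced_def finite_subset)

lemma adjacent_sym: "adjacent G u v \<Longrightarrow> adjacent G v u"
  by (simp add: adjacent_def insert_commute)

lemma adjacent_verts: "simple_graph G \<Longrightarrow> adjacent G u v \<Longrightarrow> u \<in> verts G \<and> v \<in> verts G"
  by (auto simp: adjacent_def simple_graph_def)

lemma adjacent_neq: "simple_graph G \<Longrightarrow> adjacent G u v \<Longrightarrow> u \<noteq> v"
  by (fastforce simp: adjacent_def simple_graph_def)

text \<open>Simple graphs over one vertex type are exactly what the classes in a deck consist of, so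
  an invariant in this sense has a value on each card class.\<close>

definition iso_invariant :: "('a ugraph \<Rightarrow> 'b) \<Rightarrow> bool" where
  "iso_invariant \<Phi> \<longleftrightarrow>
     (\<forall>H K. simple_graph H \<longrightarrow> simple_graph K \<longrightarrow> isomorphic H K \<longrightarrow> \<Phi> H = \<Phi> K)"

lemma isomorphic_induced:
  assumes f: "bij_betw f (verts H) (verts K)"
    and adj: "\<forall>u\<in>verts H. \<forall>v\<in>verts H. adjacent H u v \<longleftrightarrow> adjacent K (f u) (f v)"
    and S: "S \<subseteq> verts H"
  shows "isomorphic (induced H S) (induced K (f ` S))"
  unfolding isomorphic_def
proof (intro exI[of _ f] conjI ballI)
  show "bij_betw f (verts (induced H S)) (verts (induced K (f ` S)))"
    using f S by (auto intro: bij_betw_subset)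
qed (use adj S in auto)

text \<open>An isomorphism acts on vertex subsets, keeping their sizes and their induced subgraphs
  up to isomorphism. This serves both for the weights in Kelly's lemma and for Moebius
  transforms.\<close>

lemma iso_invariant_sum_induced:
  fixes \<Phi> :: "'a ugraph \<Rightarrow> 'b :: semiring_0"
  assumes "iso_invariant \<Phi>"
  shows "iso_invariant (\<lambda>H. \<Sum>S\<in>Pow (verts H). w (card S) * \<Phi> (induced H S))"
  unfolding iso_invariant_def
proof (intro allI impI)
  fix H K :: "'a ugraph"
  assume H: "simple_graph H" and K: "simple_graph K" and "isomorphic H K"
  then obtain f where f: "bij_betw f (verts H) (verts K)"
    and adj: "\<forall>u\<in>verts H. \<forall>v\<in>verts H. adjacent H u v \<longleftrightarrow> adjacent K (f u) (f v)"
    unfolding isomorphic_def by blast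
  have sub: "f ` S \<subseteq> verts K" if "S \<subseteq> verts H" for S
    using f that by (auto simp: bij_betw_def)
  have "w (card S) * \<Phi> (induced H S) = w (card (f ` S)) * \<Phi> (induced K (f ` S))"
    if S: "S \<subseteq> verts H" for S
  proof -
    have "card (f ` S) = card S"
      using f S by (meson bij_betw_def card_image inj_on_subset)
    moreover have "\<Phi> (induced H S) = \<Phi> (induced K (f ` S))"
      using assms isomorphic_induced[OF f adj S] simple_graph_induced[OF H S]
        simple_graph_induced[OF K sub[OF S]]
      unfolding iso_invariant_def by blast
    ultimately show ?thesis by simp
  qed
  then have "(\<Sum>S\<in>Pow (verts H). w (card S) * \<Phi> (induced H S))
      = (\<Sum>S\<in>Pow (verts H). w (card (f ` S)) * \<Phi> (induced K (f ` S)))"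
    by (intro sum.cong) auto
  also have "\<dots> = (\<Sum>S\<in>Pow (verts K). w (card S) * \<Phi> (induced K S))"
    using bij_betw_Pow[OF f]
    by (rule sum.reindex_bij_betw[where h = "image f" and g = "\<lambda>S. w (card S) * \<Phi> (induced K S)"])
  finally show "(\<Sum>S\<in>Pow (verts H). w (card S) * \<Phi> (induced H S))
      = (\<Sum>S\<in>Pow (verts K). w (card S) * \<Phi> (induced K S))" .
qed

text \<open>Any representative of a card class gives the right value, so the sum over the cards is a
  function of the deck alone.\<close>

lemma sum_deck:
  fixes \<Phi> :: "'a ugraph \<Rightarrow> 'b :: comm_monoid_add"
  assumes \<Phi>: "iso_invariant \<Phi>" and G: "simple_graph G"
  shows "(\<Sum>S | S \<subseteq> verts G \<and> card S = l. \<Phi> (induced G S))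
       = sum_mset (image_mset (\<lambda>c. \<Phi> (SOME H. H \<in> c)) (deck l G))"
proof -
  have "\<Phi> (induced G S) = \<Phi> (SOME H. H \<in> iso_class (induced G S))" if "S \<subseteq> verts G" for S
  proof -
    have s: "simple_graph (induced G S)"
      using G that by (rule simple_graph_induced)
    then have "induced G S \<in> iso_class (induced G S)"
      by (simp add: iso_class_def isomorphic_refl)
    then have "(SOME H. H \<in> iso_class (induced G S)) \<in> iso_class (induced G S)"
      by (rule someI)
    then show ?thesis
      using \<Phi> s unfolding iso_class_def iso_invariant_def by blast
  qed
  then have "(\<Sum>S | S \<subseteq> verts G \<and> card S = l. \<Phi> (induced G S))
      = (\<Sum>S | S \<subseteq> verts G \<and> card S = l. \<Phi> (SOME H. H \<in> iso_class (induced G S)))"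
    by (intro sum.cong) auto
  then show ?thesis
    by (simp add: deck_def sum_unfold_sum_mset multiset.map_comp comp_def)
qed

text \<open>Transfers a single card, ignoring multiplicities; this is how short cycles and large
  balls are carried from one graph to the other.\<close>

lemma deck_eq_card:
  assumes "simple_graph G" "simple_graph G'" "deck l G = deck l G'"
    and "S \<subseteq> verts G" "card S = l"
  obtains S' where "S' \<subseteq> verts G'" "card S' = l" "isomorphic (induced G S) (induced G' S')"
proof -
  have fin: "finite {S. S \<subseteq> verts H \<and> card S = l}" if "simple_graph H" for H :: "'a ugraph"
    using simple_graph_finite[OF that] by simp
  have "iso_class (induced G S) \<in># deck l G"
    using assms(4,5) fin[OF assms(1)] by (simp add: deck_def)
  then have "iso_class (induced G S) \<in># deck l G'"
    using assms(3) by simp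
  then obtain S' where S': "S' \<subseteq> verts G'" "card S' = l"
    and "iso_class (induced G S) = iso_class (induced G' S')"
    using fin[OF assms(2)] by (auto simp: deck_def)
  then have "isomorphic (induced G S) (induced G' S')"
    using iso_class_eq_iff simple_graph_induced assms by metis
  with S' that show thesis by blast
qed

lemma card_supersets:
  assumes V: "finite V" and S: "S \<subseteq> V" "card S \<le> l"
  shows "card {L. L \<subseteq> V \<and> card L = l \<and> S \<subseteq> L} = (card V - card S) choose (l - card S)"
proof -
  have finS: "finite S" using V S(1) finite_subset by blast
  have "bij_betw (\<lambda>L. L - S) {L. L \<subseteq> V \<and> card L = l \<and> S \<subseteq> L}
          {B. B \<subseteq> V - S \<and> card B = l - card S}"
  proof (rule bij_betw_byWitness[where f' = "\<lambda>B. B \<union> S"])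
    show "(\<lambda>L. L - S) ` {L. L \<subseteq> V \<and> card L = l \<and> S \<subseteq> L} \<subseteq> {B. B \<subseteq> V - S \<and> card B = l - card S}"
      using finS by (auto simp: card_Diff_subset)
    show "(\<lambda>B. B \<union> S) ` {B. B \<subseteq> V - S \<and> card B = l - card S}
        \<subseteq> {L. L \<subseteq> V \<and> card L = l \<and> S \<subseteq> L}"
    proof clarsimp
      fix B assume B: "B \<subseteq> V - S" "card B = l - card S"
      then have "finite B" "B \<inter> S = {}" using V finite_subset by blast+
      then have "card (B \<union> S) = l"
        using finS B S by (simp add: card_Un_disjoint)
      then show "B \<subseteq> V \<and> S \<subseteq> V \<and> card (B \<union> S) = l" using B S by blast
    qed
  qed auto
  then show ?thesis
    using V finS S by (simp add: bij_betw_same_card n_subsets card_Diff_subset)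
qed

text \<open>Kelly's lemma: every subset S lies in exactly
  (n - |S| choose l - |S|) subsets of size l, so dividing the weights by this number reduces
  the claim to a sum over the cards.\<close>

lemma deck_eq_weighted_sum:
  fixes \<Phi> :: "'a ugraph \<Rightarrow> real" and w :: "nat \<Rightarrow> real"
  assumes \<Phi>: "iso_invariant \<Phi>"
    and G: "simple_graph G" "simple_graph G'" "card (verts G) = card (verts G')"
    and deck: "deck l G = deck l G'" and l: "l \<le> card (verts G)"
    and w: "\<And>s. s > l \<Longrightarrow> w s = 0"
  shows "(\<Sum>S\<in>Pow (verts G). w (card S) * \<Phi> (induced G S))
       = (\<Sum>S\<in>Pow (verts G'). w (card S) * \<Phi> (induced G' S))"
proof -
  define w' where "w' s = w s / real ((card (verts G) - s) choose (l - s))" for s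
  define \<Psi> where "\<Psi> = (\<lambda>H :: 'a ugraph. \<Sum>S\<in>Pow (verts H). w' (card S) * \<Phi> (induced H S))"
  have \<Psi>: "iso_invariant \<Psi>"
    unfolding \<Psi>_def by (rule iso_invariant_sum_induced[OF \<Phi>])
  have "(\<Sum>S\<in>Pow (verts H). w (card S) * \<Phi> (induced H S))
      = (\<Sum>L | L \<subseteq> verts H \<and> card L = l. \<Psi> (induced H L))"
    if H: "simple_graph H" and cH: "card (verts H) = card (verts G)" for H :: "'a ugraph"
  proof -
    have fin: "finite (verts H)" using H by (rule simple_graph_finite)
    have "(\<Sum>L | L \<subseteq> verts H \<and> card L = l. \<Psi> (induced H L))
        = (\<Sum>L | L \<subseteq> verts H \<and> card L = l.
             \<Sum>S\<in>{S. S \<in> Pow (verts H) \<and> S \<subseteq> L}. w' (card S) * \<Phi> (induced H S))"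
      unfolding \<Psi>_def by (intro sum.cong) (auto simp: induced_induced)
    also have "\<dots> = (\<Sum>S\<in>Pow (verts H).
        \<Sum>L | L \<in> {L. L \<subseteq> verts H \<and> card L = l} \<and> S \<subseteq> L. w' (card S) * \<Phi> (induced H S))"
      using fin by (intro sum.swap_restrict) auto
    also have "\<dots> = (\<Sum>S\<in>Pow (verts H). w (card S) * \<Phi> (induced H S))"
    proof (rule sum.cong[OF refl])
      fix S assume S: "S \<in> Pow (verts H)"
      show "(\<Sum>L | L \<in> {L. L \<subseteq> verts H \<and> card L = l} \<and> S \<subseteq> L. w' (card S) * \<Phi> (induced H S))
          = w (card S) * \<Phi> (induced H S)"
      proof (cases "card S \<le> l")
        case True
        \<comment> \<open>Since \<open>l\<close> is at most the number of vertices, some card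
          contains \<open>S\<close>, and the division in \<open>w'\<close> cancels.\<close>
        have "(card (verts G) - card S) choose (l - card S) \<noteq> 0"
          using l True by (simp add: binomial_eq_0_iff)
        then show ?thesis
          using card_supersets[OF fin _ True] S cH by (simp add: w'_def conj_assoc)
      next
        case False
        then show ?thesis by (simp add: w w'_def)
      qed
    qed
    finally show ?thesis by simp
  qed
  from this[OF G(1)] this[OF G(2)] show ?thesis
    using sum_deck[OF \<Psi> G(1), of l] sum_deck[OF \<Psi> G(2), of l] deck G(3) by simp
qed

section \<open>Moebius inversion for functions that depend on few vertices\<close>

lemma alternating_sum_eq_0:
  fixes h :: "'a set \<Rightarrow> 'b :: ring_1"
  assumes "finite S" "x \<in> S" and h: "\<And>T. T \<subseteq> S \<Longrightarrow> h (insert x T) = h T"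
  shows "(\<Sum>T\<in>Pow S. (-1) ^ card T * h T) = 0"
proof -
  \<comment> \<open>\<open>Pow S\<close> consists of the subsets \<open>T\<close> of
    \<open>R\<close> and their extensions \<open>insert x T\<close>; within each such pair the signs
    are opposite and the values of \<open>h\<close> agree.\<close>
  define R where "R = S - {x}"
  have S: "S = insert x R" and R: "x \<notin> R" "finite R"
    using assms by (auto simp: R_def)
  have "(\<Sum>T\<in>Pow S. (-1) ^ card T * h T)
      = (\<Sum>T\<in>Pow R. (-1) ^ card T * h T) + (\<Sum>T\<in>insert x ` Pow R. (-1) ^ card T * h T)"
    unfolding S Pow_insert using R by (intro sum.union_disjoint) auto
  also have "(\<Sum>T\<in>insert x ` Pow R. (-1) ^ card T * h T)
      = (\<Sum>T\<in>Pow R. (-1) ^ card (insert x T) * h (insert x T))"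
    using R by (subst sum.reindex) (auto simp: inj_on_def)
  also have "\<dots> = (\<Sum>T\<in>Pow R. - ((-1) ^ card T * h T))"
  proof (rule sum.cong[OF refl])
    fix T assume "T \<in> Pow R"
    then have "x \<notin> T" "finite T" "T \<subseteq> S" using R S finite_subset by auto
    then show "(-1) ^ card (insert x T) * h (insert x T) = - ((-1) ^ card T * h T)"
      using h by simp
  qed
  finally show ?thesis by (simp add: sum_negf)
qed

text \<open>Full Moebius inversion sums over all \<open>S\<close>, but the inner sum vanishes as
  soon as \<open>S\<close> has an element outside \<open>B\<close>. What survives has at most
  \<open>card B\<close> elements, so cutting off at \<open>l\<close> loses nothing. The cut-off
  depends on \<open>card S\<close> only, not on \<open>B\<close>, which later makes the weights the
  same for all vertices.\<close>

lemma moebius_local: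
  fixes h :: "'a set \<Rightarrow> real"
  assumes V: "finite V" and B: "B \<subseteq> V" "card B \<le> l"
    and h: "\<And>S. S \<subseteq> V \<Longrightarrow> h S = h (S \<inter> B)"
  shows "h V = (\<Sum>S\<in>Pow V. (if card S \<le> l then (-1) ^ card S else 0)
                  * (\<Sum>T\<in>Pow S. (-1) ^ card T * h T))"
proof -
  define g where "g S = (\<Sum>T\<in>Pow S. (-1) ^ card T * h T)" for S
  have "h V = (\<Sum>S\<in>Pow V. (-1) ^ card S * g S)"
    by (rule inclusion_exclusion_symmetric) (simp_all add: g_def V)
  also have "\<dots> = (\<Sum>S\<in>Pow V. (if card S \<le> l then (-1) ^ card S else 0) * g S)"
  proof (rule sum.cong[OF refl])
    fix S assume S: "S \<in> Pow V"
    show "(-1) ^ card S * g S = (if card S \<le> l then (-1) ^ card S else 0) * g S"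
    proof (cases "S \<subseteq> B")
      case True
      then have "card S \<le> l"
        using B V by (meson card_mono finite_subset order_trans)
      then show ?thesis by simp
    next
      case False
      then obtain x where x: "x \<in> S" "x \<notin> B" by blast
      have "g S = 0"
        unfolding g_def
      proof (rule alternating_sum_eq_0[OF _ x(1)])
        show "finite S" using S V finite_subset by auto
        fix T assume "T \<subseteq> S"
        then have "insert x T \<subseteq> V" "T \<subseteq> V" using S x by auto
        then show "h (insert x T) = h T"
          using x h by (metis Int_insert_left_if0)
      qed
      then show ?thesis by simp
    qed
  qed
  finally show ?thesis by (simp add: g_def)
qed

section \<open>Non-backtracking walks and balls\<close>

text \<open>The length \<open>m\<close> counts edges; the values of \<open>f\<close> beyond
  \<open>m\<close> are unconstrained.\<close>

definition nb_walk :: "'a ugraph \<Rightarrow> (nat \<Rightarrow> 'a) \<Rightarrow> nat \<Rightarrow> bool" where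
  "nb_walk G f m \<longleftrightarrow> (\<forall>i\<le>m. f i \<in> verts G) \<and> (\<forall>i<m. adjacent G (f i) (f (Suc i)))
     \<and> (\<forall>i. Suc i < m \<longrightarrow> f i \<noteq> f (Suc (Suc i)))"

text \<open>In a forest with \<open>r \<ge> 1\<close> this says that \<open>v\<close> is the
  midpoint of a path with \<open>2 * r\<close> edges. Walks are used instead of paths so that they
  may wind around a cycle, which makes every vertex of a cycle middle. For \<open>r = 0\<close> the
  values \<open>f 1\<close> and \<open>g 1\<close> are unconstrained.\<close>

definition middle :: "'a ugraph \<Rightarrow> nat \<Rightarrow> 'a \<Rightarrow> bool" where
  "middle G r v \<longleftrightarrow>
     (\<exists>f g. nb_walk G f r \<and> nb_walk G g r \<and> f 0 = v \<and> g 0 = v \<and> f 1 \<noteq> g 1)"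

primrec ball :: "'a ugraph \<Rightarrow> 'a \<Rightarrow> nat \<Rightarrow> 'a set" where
  "ball G v 0 = {v}"
| "ball G v (Suc r) = ball G v r \<union> {w. \<exists>u\<in>ball G v r. adjacent G u w}"

lemma ball_mono: "i \<le> j \<Longrightarrow> ball G v i \<subseteq> ball G v j"
  by (rule lift_Suc_mono_le[of "ball G v"]) auto

lemma ball_subset_verts: "simple_graph G \<Longrightarrow> v \<in> verts G \<Longrightarrow> ball G v r \<subseteq> verts G"
  by (induction r) (auto dest: adjacent_verts)

lemma center_in_ball: "v \<in> ball G v r"
  using ball_mono[of 0 r G v] by simp

lemma ball_induced_subset: "ball (induced G S) v r \<subseteq> ball G v r"
  by (induction r) auto

lemma ball_subset_induced: "ball G v r \<subseteq> S \<Longrightarrow> ball G v r \<subseteq> ball (induced G S) v r"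
proof (induction r)
  case (Suc r)
  have "w \<in> ball (induced G S) v (Suc r)" if "u \<in> ball G v r" "adjacent G u w" for u w
  proof -
    have "u \<in> S" "w \<in> S" "u \<in> ball (induced G S) v r" using that Suc by auto
    then show ?thesis using that by auto
  qed
  then show ?case using Suc by auto
qed simp

text \<open>A ball with at least \<open>l\<close> vertices leaves a trace on a card: an
  \<open>l\<close>-set that is a ball of radius \<open>r\<close> in its own induced subgraph, hence
  recognisable after passing to the other graph.\<close>

lemma large_ball_induced:
  assumes "finite (ball G v r)" "1 \<le> l" "l \<le> card (ball G v r)"
  shows "\<exists>S. v \<in> S \<and> S \<subseteq> ball (induced G S) v r \<and> S \<subseteq> ball G v r \<and> card S = l"
  using assms
proof (induction r)
  case 0
  then show ?case by (intro exI[of _ "{v}"]) auto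
next
  case (Suc r)
  show ?case
  proof (cases "l \<le> card (ball G v r)")
    case True
    then obtain S where "v \<in> S" "S \<subseteq> ball (induced G S) v r" "S \<subseteq> ball G v r" "card S = l"
      using Suc by auto
    then show ?thesis by (intro exI[of _ S]) auto
  next
    case False
    \<comment> \<open>The smaller ball is kept whole, so every further vertex of \<open>S\<close>
      still has a neighbour in it and is reached inside \<open>S\<close>.\<close>
    then obtain S where S: "ball G v r \<subseteq> S" "S \<subseteq> ball G v (Suc r)" "card S = l"
      using exists_subset_between[of "ball G v r" l "ball G v (Suc r)"] Suc.prems ball_mono[of r "Suc r" G v]
      by auto
    have "S \<subseteq> ball (induced G S) v (Suc r)"
    proof
      fix w assume w: "w \<in> S"
      from w S(2) consider "w \<in> ball G v r" | u where "u \<in> ball G v r" "adjacent G u w"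
        by auto
      then show "w \<in> ball (induced G S) v (Suc r)"
      proof cases
        case 2
        then have "u \<in> ball (induced G S) v r" "u \<in> S" using S ball_subset_induced[OF S(1)] by auto
        then show ?thesis using 2 w by auto
      qed (use ball_subset_induced[OF S(1)] in auto)
    qed
    moreover have "v \<in> S" using center_in_ball S(1) by fast
    ultimately show ?thesis using S by blast
  qed
qed

lemma ball_isomorphic:
  assumes f: "bij_betw f (verts H) (verts K)" and H: "simple_graph H"
    and adj: "\<forall>u\<in>verts H. \<forall>v\<in>verts H. adjacent H u v \<longleftrightarrow> adjacent K (f u) (f v)"
    and v: "v \<in> verts H"
  shows "f ` ball H v r \<subseteq> ball K (f v) r"
proof (induction r)
  case (Suc r)
  have "f w \<in> ball K (f v) (Suc r)" if "u \<in> ball H v r" "adjacent H u w" for u w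
  proof -
    have "adjacent K (f u) (f w)" using that adj adjacent_verts[OF H] by blast
    then show ?thesis using that Suc by auto
  qed
  then show ?case using Suc by auto
qed simp

section \<open>Locality and isomorphism invariance of middle vertices\<close>

lemma nb_walk_in_ball: "nb_walk G f m \<Longrightarrow> i \<le> m \<Longrightarrow> f i \<in> ball G (f 0) i"
  by (induction i) (auto simp: nb_walk_def Suc_le_eq)

lemma nb_walk_induced:
  "nb_walk (induced G S) f m \<longleftrightarrow> nb_walk G f m \<and> f ` {..m} \<subseteq> S" if "S \<subseteq> verts G"
  using that unfolding nb_walk_def by fastforce

text \<open>Walks of length \<open>r\<close> from \<open>v\<close> stay in the ball of radius
  \<open>r\<close>. This is the hypothesis on \<open>h\<close> that \<open>moebius_local\<close>
  asks for.\<close>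

lemma middle_local:
  assumes S: "S \<subseteq> verts G" and B: "ball G v r \<subseteq> B"
  shows "middle (induced G S) r v \<longleftrightarrow> middle (induced G (S \<inter> B)) r v"
proof -
  have "nb_walk (induced G S) f r \<longleftrightarrow> nb_walk (induced G (S \<inter> B)) f r" if "f 0 = v" for f
  proof -
    have "f ` {..r} \<subseteq> B" if "nb_walk G f r"
      using nb_walk_in_ball[OF that] \<open>f 0 = v\<close> B ball_mono[of _ r G v] by (force simp: subset_iff)
    moreover have "S \<inter> B \<subseteq> verts G" using S by blast
    ultimately show ?thesis
      unfolding nb_walk_induced[OF S] nb_walk_induced[OF \<open>S \<inter> B \<subseteq> verts G\<close>] by blast
  qed
  then show ?thesis unfolding middle_def by (auto cong: conj_cong)
qed

lemma middle_in_verts: "middle G r v \<Longrightarrow> v \<in> verts G"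
  by (auto simp: middle_def nb_walk_def)

lemma middle_isomorphic:
  assumes f: "bij_betw f (verts H) (verts K)"
    and adj: "\<forall>u\<in>verts H. \<forall>v\<in>verts H. adjacent H u v \<longleftrightarrow> adjacent K (f u) (f v)"
    and r: "r \<ge> 1" and v: "middle H r v"
  shows "middle K r (f v)"
proof -
  obtain g h where gh: "nb_walk H g r" "nb_walk H h r" "g 0 = v" "h 0 = v" "g 1 \<noteq> h 1"
    using v unfolding middle_def by blast
  have inj: "f x = f y \<longleftrightarrow> x = y" if "x \<in> verts H" "y \<in> verts H" for x y
    using f that by (auto simp: bij_betw_def inj_on_def)
  have walk: "nb_walk K (f \<circ> w) r" if "nb_walk H w r" for w
    unfolding nb_walk_def
  proof (intro conjI allI impI)
    have in_H: "w i \<in> verts H" if "i \<le> r" for i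
      using \<open>nb_walk H w r\<close> that by (simp add: nb_walk_def)
    show "(f \<circ> w) i \<in> verts K" if "i \<le> r" for i
      using in_H[OF that] f by (simp add: bij_betwE)
    show "adjacent K ((f \<circ> w) i) ((f \<circ> w) (Suc i))" if "i < r" for i
    proof -
      have "adjacent H (w i) (w (Suc i))" "w i \<in> verts H" "w (Suc i) \<in> verts H"
        using \<open>nb_walk H w r\<close> that by (auto simp: nb_walk_def)
      then show ?thesis using adj by auto
    qed
    show "(f \<circ> w) i \<noteq> (f \<circ> w) (Suc (Suc i))" if "Suc i < r" for i
      using \<open>nb_walk H w r\<close> that in_H[of i] in_H[of "Suc (Suc i)"] inj by (simp add: nb_walk_def)
  qed
  \<comment> \<open>As \<open>r \<ge> 1\<close>, both second vertices lie in \<open>verts H\<close>,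
    where \<open>f\<close> is injective.\<close>
  have "f (g 1) \<noteq> f (h 1)"
    using gh r inj unfolding nb_walk_def by blast
  then show ?thesis
    unfolding middle_def using gh walk by (intro exI[of _ "f \<circ> g"] exI[of _ "f \<circ> h"]) auto
qed

section \<open>Reconstructing the numbers of middle vertices and of edges\<close>

lemma iso_invariant_card_middle:
  assumes r: "r \<ge> 1"
  shows "iso_invariant (\<lambda>H. real (card {v. middle H r v}))"
proof -
  have le: "card {v. middle H r v} \<le> card {v. middle K r v}"
    if "isomorphic H K" "finite (verts K)" for H K :: "'a ugraph"
  proof -
    obtain f where f: "bij_betw f (verts H) (verts K)"
      and adj: "\<forall>u\<in>verts H. \<forall>v\<in>verts H. adjacent H u v \<longleftrightarrow> adjacent K (f u) (f v)"
      using \<open>isomorphic H K\<close> unfolding isomorphic_def by blast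
    have "inj_on f {v. middle H r v}"
      using f by (auto simp: bij_betw_def dest: middle_in_verts intro: inj_on_subset)
    moreover have "f ` {v. middle H r v} \<subseteq> {v. middle K r v}"
      using middle_isomorphic[OF f adj r] by blast
    moreover have "finite {v. middle K r v}"
      using that(2) middle_in_verts by (metis finite_subset mem_Collect_eq subsetI)
    ultimately show ?thesis by (rule card_inj_on_le)
  qed
  show ?thesis
    unfolding iso_invariant_def
    using le by (auto intro!: antisym dest: simple_graph_finite intro: isomorphic_sym)
qed

text \<open>The number is a sum of 0/1 indicators, one per vertex, and each is expanded by
  \<open>moebius_local\<close> around its own ball. The weights \<open>w\<close> do not depend on
  the vertex, so the sums can be exchanged; the result is a weighted sum over induced subgraphs with
  at most \<open>l\<close> vertices, to which Kelly's lemma applies.\<close>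

lemma deck_eq_card_middle:
  fixes G G' :: "'a ugraph"
  assumes r: "r \<ge> 1"
    and G: "simple_graph G" "simple_graph G'" "card (verts G) = card (verts G')"
    and deck: "deck l G = deck l G'" and l: "l \<le> card (verts G)"
    and ball: "\<And>v. v \<in> verts G \<Longrightarrow> card (ball G v r) \<le> l"
    and ball': "\<And>v. v \<in> verts G' \<Longrightarrow> card (ball G' v r) \<le> l"
  shows "card {v. middle G r v} = card {v. middle G' r v}"
proof -
  define \<mu> where "\<mu> = (\<lambda>H :: 'a ugraph. real (card {v. middle H r v}))"
  \<comment> \<open>The Moebius transform of \<open>\<mu>\<close>; it arises as the sum over all
    vertices of the transforms of the indicators.\<close>
  define \<Phi> where "\<Phi> = (\<lambda>H. \<Sum>T\<in>Pow (verts H). (-1) ^ card T * \<mu> (induced H T))"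
  define w :: "nat \<Rightarrow> real" where "w s = (if s \<le> l then (-1) ^ s else 0)" for s
  have \<Phi>: "iso_invariant \<Phi>"
    unfolding \<Phi>_def \<mu>_def
    by (rule iso_invariant_sum_induced[OF iso_invariant_card_middle[OF r]])
  have "\<mu> H = (\<Sum>S\<in>Pow (verts H). w (card S) * \<Phi> (induced H S))"
    if H: "simple_graph H" and ballH: "\<And>v. v \<in> verts H \<Longrightarrow> card (ball H v r) \<le> l" for H :: "'a ugraph"
  proof -
    have fin: "finite (verts H)" using H by (rule simple_graph_finite)
    define h :: "'a \<Rightarrow> 'a set \<Rightarrow> real" where "h v S = of_bool (middle (induced H S) r v)" for v S
    have mu: "\<mu> (induced H T) = (\<Sum>v\<in>verts H. h v T)" if "T \<subseteq> verts H" for T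
    proof -
      have "{v. middle (induced H T) r v} = verts H \<inter> {v. middle (induced H T) r v}"
        using middle_in_verts[of "induced H T" r] that by auto
      then show ?thesis
        using fin by (simp add: \<mu>_def h_def of_bool_def sum.If_cases)
    qed
    have "\<mu> H = (\<Sum>v\<in>verts H. h v (verts H))"
      using mu[of "verts H"] by (simp add: induced_verts[OF H])
    also have "\<dots> = (\<Sum>v\<in>verts H. \<Sum>S\<in>Pow (verts H).
        w (card S) * (\<Sum>T\<in>Pow S. (-1) ^ card T * h v T))"
    proof (rule sum.cong[OF refl])
      fix v assume v: "v \<in> verts H"
      show "h v (verts H) = (\<Sum>S\<in>Pow (verts H).
          w (card S) * (\<Sum>T\<in>Pow S. (-1) ^ card T * h v T))"
        unfolding w_def
      proof (rule moebius_local[OF fin ball_subset_verts[OF H v] ballH[OF v]])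
        show "h v S = h v (S \<inter> ball H v r)" if "S \<subseteq> verts H" for S
          unfolding h_def using middle_local[OF that order_refl] by simp
      qed
    qed
    also have "\<dots> = (\<Sum>S\<in>Pow (verts H). \<Sum>v\<in>verts H.
        w (card S) * (\<Sum>T\<in>Pow S. (-1) ^ card T * h v T))"
      by (rule sum.swap)
    also have "\<dots> = (\<Sum>S\<in>Pow (verts H). w (card S) * \<Phi> (induced H S))"
    proof (rule sum.cong[OF refl])
      fix S assume S: "S \<in> Pow (verts H)"
      have "(\<Sum>v\<in>verts H. w (card S) * (\<Sum>T\<in>Pow S. (-1) ^ card T * h v T))
          = w (card S) * (\<Sum>v\<in>verts H. \<Sum>T\<in>Pow S. (-1) ^ card T * h v T)"
        by (simp add: sum_distrib_left)
      also have "(\<Sum>v\<in>verts H. \<Sum>T\<in>Pow S. (-1) ^ card T * h v T)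
          = (\<Sum>T\<in>Pow S. \<Sum>v\<in>verts H. (-1) ^ card T * h v T)"
        by (rule sum.swap)
      also have "\<dots> = \<Phi> (induced H S)"
        unfolding \<Phi>_def
      proof (rule sum.cong)
        fix T assume "T \<in> Pow (verts (induced H S))"
        then have "T \<subseteq> S" "T \<subseteq> verts H" using S by auto
        then show "(\<Sum>v\<in>verts H. (-1) ^ card T * h v T)
            = (-1) ^ card T * \<mu> (induced (induced H S) T)"
          by (simp add: mu induced_induced sum_distrib_left)
      qed simp
      finally show "(\<Sum>v\<in>verts H. w (card S) * (\<Sum>T\<in>Pow S. (-1) ^ card T * h v T))
          = w (card S) * \<Phi> (induced H S)" .
    qed
    finally show ?thesis .
  qed
  from this[OF G(1) ball] this[OF G(2) ball']
  have "\<mu> G = \<mu> G'"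
    using deck_eq_weighted_sum[OF \<Phi> G deck l, of w] by (simp add: w_def)
  then show ?thesis by (simp add: \<mu>_def)
qed

text \<open>Kelly's lemma with all weight on the 2-subsets, where \<open>\<Phi>\<close> tests
  whether the two vertices are adjacent.\<close>

lemma deck_eq_card_edges:
  fixes G G' :: "'a ugraph"
  assumes G: "simple_graph G" "simple_graph G'" "card (verts G) = card (verts G')"
    and deck: "deck l G = deck l G'" and l: "2 \<le> l" "l \<le> card (verts G)"
  shows "card (edges G) = card (edges G')"
proof -
  define \<Phi> where
    "\<Phi> = (\<lambda>H :: 'a ugraph. of_bool (\<exists>u\<in>verts H. \<exists>v\<in>verts H. adjacent H u v) :: real)"
  have "isomorphic H K \<Longrightarrow> \<exists>u\<in>verts H. \<exists>v\<in>verts H. adjacent H u v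
      \<Longrightarrow> \<exists>u\<in>verts K. \<exists>v\<in>verts K. adjacent K u v" for H K :: "'a ugraph"
    unfolding isomorphic_def by (blast dest: bij_betwE)
  then have \<Phi>: "iso_invariant \<Phi>"
    unfolding iso_invariant_def \<Phi>_def
    by (intro allI impI arg_cong[of _ _ of_bool] iffI) (blast dest: isomorphic_sym)+
  have "real (card (edges H)) = (\<Sum>S\<in>Pow (verts H). of_bool (card S = 2) * \<Phi> (induced H S))"
    if H: "simple_graph H" for H :: "'a ugraph"
  proof -
    have "of_bool (card S = 2) * \<Phi> (induced H S) = of_bool (S \<in> edges H)" if "S \<subseteq> verts H" for S
    proof (cases "card S = 2")
      case True
      then obtain a b where "S = {a, b}" "a \<noteq> b" by (auto simp: card_2_iff)
      then have "(\<exists>u\<in>S. \<exists>v\<in>S. adjacent H u v) \<longleftrightarrow> adjacent H a b"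
        using adjacent_neq[OF H] adjacent_sym[of H] by blast
      then show ?thesis
        using True \<open>S = {a, b}\<close> unfolding \<Phi>_def by (simp add: adjacent_def[symmetric])
    next
      case False
      then show ?thesis using H by (auto simp: simple_graph_def)
    qed
    then have "(\<Sum>S\<in>Pow (verts H). of_bool (card S = 2) * \<Phi> (induced H S))
        = (\<Sum>S\<in>Pow (verts H). of_bool (S \<in> edges H))"
      by (intro sum.cong) auto
    also have "\<dots> = real (card (Pow (verts H) \<inter> edges H))"
      using simple_graph_finite[OF H] by (simp add: of_bool_def sum.If_cases)
    also have "Pow (verts H) \<inter> edges H = edges H"
      using H by (auto simp: simple_graph_def)
    finally show ?thesis by simp
  qed
  from this[OF G(1)] this[OF G(2)]
  have "real (card (edges G)) = real (card (edges G'))"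
    using deck_eq_weighted_sum[OF \<Phi> G deck l(2), of "\<lambda>s. of_bool (s = 2)"] l(1) by simp
  then show ?thesis by simp
qed

section \<open>Forests\<close>

lemma nb_walk_drop: "nb_walk G f m \<Longrightarrow> i \<le> m \<Longrightarrow> nb_walk G (\<lambda>j. f (i + j)) (m - i)"
  unfolding nb_walk_def by auto

lemma nb_walk_rev:
  assumes "nb_walk G f m"
  shows "nb_walk G (\<lambda>j. f (m - j)) m"
  unfolding nb_walk_def
proof (intro conjI allI impI)
  show "adjacent G (f (m - i)) (f (m - Suc i))" if "i < m" for i
  proof -
    have "adjacent G (f (m - Suc i)) (f (Suc (m - Suc i)))"
      using assms that unfolding nb_walk_def by simp
    then show ?thesis using that by (simp add: Suc_diff_Suc adjacent_sym)
  qed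
  show "f (m - i) \<noteq> f (m - Suc (Suc i))" if "Suc i < m" for i
  proof -
    have "f (m - Suc (Suc i)) \<noteq> f (Suc (Suc (m - Suc (Suc i))))"
      using assms that unfolding nb_walk_def by simp
    moreover have "Suc (Suc (m - Suc (Suc i))) = m - i" using that by simp
    ultimately show ?thesis by simp
  qed
qed (use assms in \<open>simp add: nb_walk_def\<close>)

text \<open>Follow \<open>f\<close> backwards to the common start and continue along
  \<open>g\<close>; the different first steps rule out backtracking at the joint.\<close>

lemma nb_walk_join:
  assumes f: "nb_walk G f a" and g: "nb_walk G g b" and "f 0 = g 0" "f 1 \<noteq> g 1"
  shows "nb_walk G (\<lambda>j. if j \<le> a then f (a - j) else g (j - a)) (a + b)"
    (is "nb_walk G ?h _")
proof -
  have r: "nb_walk G (\<lambda>j. f (a - j)) a" using f by (rule nb_walk_rev)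
  \<comment> \<open>At \<open>j = 0\<close> the definition of \<open>?h\<close> takes the value from
    \<open>f\<close>, which agrees because both walks start at the same vertex.\<close>
  have right: "?h (a + j) = g j" for j using assms(3) by (cases j) auto
  show ?thesis
    unfolding nb_walk_def
  proof (intro conjI allI impI)
    show "?h i \<in> verts G" if "i \<le> a + b" for i
      using f g that by (simp add: nb_walk_def)
    show "adjacent G (?h i) (?h (Suc i))" if "i < a + b" for i
    proof (cases "i < a")
      case True
      then show ?thesis using r by (simp add: nb_walk_def)
    next
      case False
      then obtain j where j: "i = a + j" by (auto simp: le_iff_add not_less)
      have "adjacent G (g j) (g (Suc j))"
        using g \<open>i < a + b\<close> by (simp add: nb_walk_def j)
      then have "adjacent G (?h (a + j)) (?h (a + Suc j))" unfolding right .
      then show ?thesis by (simp only: j add_Suc_right)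
    qed
    show "?h i \<noteq> ?h (Suc (Suc i))" if "Suc i < a + b" for i
    proof -
      consider "Suc i < a" | "Suc i = a" | "a \<le> i" by linarith
      then show ?thesis
      proof cases
        case 1
        then show ?thesis using r by (simp add: nb_walk_def)
      next
        case 2
        then have "?h i = f 1" "?h (Suc (Suc i)) = g 1" by auto
        then show ?thesis using assms(4) by simp
      next
        case 3
        then obtain j where j: "i = a + j" by (auto simp: le_iff_add)
        have "g j \<noteq> g (Suc (Suc j))"
          using g \<open>Suc i < a + b\<close> by (simp add: nb_walk_def j)
        then have "?h (a + j) \<noteq> ?h (a + Suc (Suc j))" unfolding right .
        then show ?thesis unfolding j add_Suc_right .
      qed
    qed
  qed
qed

text \<open>A repetition at least distance \<open>d\<close> closes up to a cycle: minimality makes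
  the vertices in between distinct, while \<open>d = 1\<close> would be a loop and
  \<open>d = 2\<close> a backtracking.\<close>

lemma nb_walk_inj_on:
  assumes G: "simple_graph G" "\<nexists>p. is_cycle G p" and f: "nb_walk G f m"
  shows "inj_on f {..m}"
proof (rule ccontr)
  assume "\<not> inj_on f {..m}"
  then obtain x y where "x \<le> m" "y \<le> m" "x \<noteq> y" "f x = f y"
    by (auto simp: inj_on_def)
  then have "\<exists>d i. d > 0 \<and> i + d \<le> m \<and> f i = f (i + d)"
    using nat_neq_iff[of x y] by (metis less_imp_add_positive)
  then obtain d where d: "\<exists>i. d > 0 \<and> i + d \<le> m \<and> f i = f (i + d)"
    and min: "\<And>e. e < d \<Longrightarrow> \<not> (\<exists>i. e > 0 \<and> i + e \<le> m \<and> f i = f (i + e))"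
    by (rule exists_least_iff[THEN iffD1, THEN exE]) blast
  then obtain i where i: "d > 0" "i + d \<le> m" "f i = f (i + d)" by blast
  have "d \<noteq> 1"
  proof
    assume "d = 1"
    then have "f i = f (Suc i)" "i < m" using i by auto
    moreover from this have "adjacent G (f i) (f (Suc i))"
      using f unfolding nb_walk_def by blast
    ultimately show False using adjacent_neq[OF G(1)] by blast
  qed
  moreover have "d \<noteq> 2"
    using i f by (auto simp: nb_walk_def)
  ultimately have d3: "d \<ge> 3" using i by linarith
  have "inj_on (\<lambda>t. f (i + t)) {0..<d}"
  proof (rule linorder_inj_onI)
    fix s t assume st: "s < t" "s \<in> {0..<d}" "t \<in> {0..<d}"
    show "f (i + s) \<noteq> f (i + t)"
    proof -
      have "t - s < d" "t - s > 0" "i + s + (t - s) = i + t" "i + t \<le> m" using st i by auto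
      then show ?thesis using min[of "t - s"] by metis
    qed
  qed auto
  then have "distinct (map (\<lambda>t. f (i + t)) [0..<d])"
    by (simp add: distinct_map)
  moreover have "adjacent G (f (i + t)) (f (i + Suc t mod d))" if "t < d" for t
  proof -
    have "adjacent G (f (i + t)) (f (i + Suc t))"
      using f i that by (auto simp: nb_walk_def)
    \<comment> \<open>Only \<open>Suc t = d\<close> is affected by the modulus; there the repetition
      \<open>f i = f (i + d)\<close> closes the cycle.\<close>
    moreover have "f (i + Suc t) = f (i + Suc t mod d)"
      using that i by (cases "Suc t = d") auto
    ultimately show ?thesis by simp
  qed
  ultimately have "is_cycle G (map (\<lambda>t. f (i + t)) [0..<d])"
    using d3 by (simp add: is_cycle_def)
  then show False using G by blast
qed

lemma nb_walk_length:
  assumes G: "simple_graph G" "\<nexists>p. is_cycle G p" and f: "nb_walk G f m"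
  shows "m < card (verts G)"
proof -
  have "card (f ` {..m}) = Suc m"
    using nb_walk_inj_on[OF assms] by (simp add: card_image)
  moreover have "card (f ` {..m}) \<le> card (verts G)"
    using f G by (intro card_mono) (auto simp: nb_walk_def simple_graph_finite)
  ultimately show ?thesis by simp
qed

lemma forest_longest_walk:
  assumes G: "simple_graph G" "\<nexists>p. is_cycle G p" and ne: "verts G \<noteq> {}"
  obtains x D where "nb_walk G x D" "\<And>h m. nb_walk G h m \<Longrightarrow> m \<le> D"
proof -
  define P where "P m \<longleftrightarrow> (\<exists>h. nb_walk G h m)" for m
  obtain a where "a \<in> verts G" using ne by blast
  then have "nb_walk G (\<lambda>_. a) 0" by (simp add: nb_walk_def)
  then have "P 0" by (auto simp: P_def)
  moreover have bound: "m \<le> card (verts G)" if "P m" for m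
    using that nb_walk_length[OF G] by (auto simp: P_def less_imp_le)
  ultimately have "P (Greatest P)" by (rule GreatestI_nat)
  moreover have "m \<le> Greatest P" if "P m" for m
    using that bound by (rule Greatest_le_nat)
  ultimately show thesis using that unfolding P_def by blast
qed

text \<open>In a forest the first r vertices of a longest walk are not middle: one of the
  two arms could be glued to the rest of the walk.\<close>

lemma longest_walk_not_middle:
  assumes longest: "\<And>g m. nb_walk G g m \<Longrightarrow> m \<le> D" and x: "nb_walk G x D"
    and i: "i < r" "i < D"
  shows "\<not> middle G r (x i)"
proof
  assume "middle G r (x i)"
  then obtain f g where fg: "nb_walk G f r" "nb_walk G g r" "f 0 = x i" "g 0 = x i" "f 1 \<noteq> g 1"
    unfolding middle_def by blast
  \<comment> \<open>The arms differ in their second vertex, so one of them avoids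
    \<open>x (i + 1)\<close>. Glued to the rest of \<open>x\<close> it has length
    \<open>r + (D - i)\<close>, which exceeds \<open>D\<close>.\<close>
  then obtain h where h: "nb_walk G h r" "h 0 = x i" "h 1 \<noteq> x (i + 1)" by metis
  have "nb_walk G (\<lambda>j. x (i + j)) (D - i)"
    using x i by (intro nb_walk_drop) auto
  from nb_walk_join[OF h(1) this] h have "\<exists>g. nb_walk G g (r + (D - i))" by auto
  then have "r + (D - i) \<le> D" using longest by blast
  then show False using i by linarith
qed

text \<open>The two arms at one middle vertex join to a walk of length \<open>2 * r\<close>. A
  longest walk is therefore long enough for its first \<open>r\<close> and its last \<open>r\<close>
  vertices to be disjoint; these \<open>2 * r\<close> distinct vertices are not middle.\<close>

lemma card_middle_forest:
  assumes G: "simple_graph G" "\<nexists>p. is_cycle G p"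
    and ex: "middle G r v"
  shows "card {v. middle G r v} + 2 * r \<le> card (verts G)"
proof -
  obtain f g where fg: "nb_walk G f r" "nb_walk G g r" "f 0 = v" "g 0 = v" "f 1 \<noteq> g 1"
    using ex unfolding middle_def by blast
  have "verts G \<noteq> {}" using middle_in_verts[OF ex] by blast
  then obtain x D where x: "nb_walk G x D" and longest: "\<And>h m. nb_walk G h m \<Longrightarrow> m \<le> D"
    using forest_longest_walk[OF G] by blast
  have "r + r \<le> D" using longest[OF nb_walk_join[OF fg(1,2)]] fg by simp
  then have rD: "2 * r \<le> D" by simp
  define I where "I = {..<r} \<union> {D - r<..D}"
  have I: "I \<subseteq> {..D}" "card I = 2 * r"
  proof -
    show "I \<subseteq> {..D}" using rD by (auto simp: I_def)
    have "card I = card {..<r} + card {D - r<..D}"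
      unfolding I_def using rD by (intro card_Un_disjoint) auto
    then show "card I = 2 * r" using rD by simp
  qed
  have "\<not> middle G r (x i)" if "i \<in> I" for i
  proof (cases "i < r")
    case True
    then show ?thesis
      using longest_walk_not_middle[OF longest x True] rD by simp
  next
    case False
    \<comment> \<open>In the reversed walk, \<open>x i\<close> stands at position
      \<open>D - i\<close>, which is among the first \<open>r\<close>.\<close>
    then have "D - i < r" "D - i < D" "D - (D - i) = i" using that rD by (auto simp: I_def)
    then show ?thesis
      using longest_walk_not_middle[OF longest nb_walk_rev[OF x] \<open>D - i < r\<close> \<open>D - i < D\<close>] \<open>D - (D - i) = i\<close> by simp
  qed
  then have disj: "{v. middle G r v} \<inter> x ` I = {}" by blast
  have sub: "{v. middle G r v} \<union> x ` I \<subseteq> verts G"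
    using x I(1) middle_in_verts[of G r] unfolding nb_walk_def by blast
  have fin: "finite (verts G)" using G(1) by (rule simple_graph_finite)
  have "card (x ` I) = 2 * r"
    using I inj_on_subset[OF nb_walk_inj_on[OF G x]] by (simp add: card_image)
  then have "card {v. middle G r v} + 2 * r = card ({v. middle G r v} \<union> x ` I)"
    using sub fin disj by (subst card_Un_disjoint) (auto intro: finite_subset)
  also have "\<dots> \<le> card (verts G)" using sub fin by (rule card_mono[rotated])
  finally show ?thesis .
qed

section \<open>Edge counts of forests and connected graphs\<close>

lemma is_cycle_induced: "is_cycle (induced G S) p \<Longrightarrow> is_cycle G p"
  by (simp add: is_cycle_def)

lemma finite_edges: "simple_graph G \<Longrightarrow> finite (edges G)"
  by (rule finite_subset[of _ "Pow (verts G)"]) (auto simp: simple_graph_def)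

text \<open>An end of a longest walk works: another neighbour would prolong the walk. If the longest
  walk has length 0, then \<open>x 1\<close> is an arbitrary value and the vertex is
  isolated.\<close>

lemma forest_low_degree_vertex:
  assumes G: "simple_graph G" "\<nexists>p. is_cycle G p" and ne: "verts G \<noteq> {}"
  obtains v u where "v \<in> verts G" "\<And>w. adjacent G v w \<Longrightarrow> w = u"
proof -
  obtain x D where x: "nb_walk G x D" and longest: "\<And>h m. nb_walk G h m \<Longrightarrow> m \<le> D"
    using forest_longest_walk[OF assms] by blast
  have "w = x 1" if w: "adjacent G (x 0) w" for w
  proof (rule ccontr)
    assume "w \<noteq> x 1"
    have "nb_walk G (case_nat (x 0) (\<lambda>_. w)) 1"
      using w adjacent_verts[OF G(1) w] by (simp add: nb_walk_def split: nat.split)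
    from nb_walk_join[OF this x] \<open>w \<noteq> x 1\<close> have "\<exists>h. nb_walk G h (1 + D)" by auto
    then show False using longest[of _ "1 + D"] by auto
  qed
  moreover have "x 0 \<in> verts G" using x by (simp add: nb_walk_def)
  ultimately show thesis using that by blast
qed

text \<open>Induction: deleting a vertex of degree at most one removes one vertex and at most one
  edge.\<close>

lemma forest_card_edges:
  assumes "simple_graph G" "\<nexists>p. is_cycle G p" "verts G \<noteq> {}"
  shows "card (edges G) < card (verts G)"
  using assms
proof (induction "card (verts G)" arbitrary: G rule: less_induct)
  case less
  note G = less.prems
  have fin: "finite (verts G)" using G(1) by (rule simple_graph_finite)
  obtain v u where v: "v \<in> verts G" and u: "\<And>w. adjacent G v w \<Longrightarrow> w = u"
    using forest_low_degree_vertex[OF G] by blast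
  define H where "H = induced G (verts G - {v})"
  have sub: "edges G \<subseteq> insert {v, u} (edges H)"
  proof
    fix e assume e: "e \<in> edges G"
    then have e2: "e \<subseteq> verts G" "card e = 2" using G(1) by (auto simp: simple_graph_def)
    show "e \<in> insert {v, u} (edges H)"
    proof (cases "v \<in> e")
      case True
      then obtain w where "e = {v, w}" using e2 by (auto simp: card_2_iff)
      then show ?thesis using u e by (auto simp: adjacent_def)
    qed (use e e2 in \<open>auto simp: H_def induced_def\<close>)
  qed
  have H: "simple_graph H" "\<nexists>p. is_cycle H p"
    using G simple_graph_induced[OF G(1)] is_cycle_induced unfolding H_def by blast+
  have cH: "Suc (card (verts H)) = card (verts G)"
    using card_Suc_Diff1[OF fin v] by (simp add: H_def)
  have finE: "finite (edges H)" using H(1) by (rule finite_edges)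
  show ?case
  proof (cases "verts H = {}")
    case True
    have "e \<notin> edges G" for e
    proof
      assume "e \<in> edges G"
      then have "e \<subseteq> {v}" "card e = 2" using G(1) True v by (auto simp: simple_graph_def H_def)
      then show False by (auto dest: subset_singletonD)
    qed
    then have "edges G = {}" by blast
    then show ?thesis using v fin by (auto simp: card_gt_0_iff)
  next
    case False
    have "card (edges G) \<le> Suc (card (edges H))"
      using card_mono[OF _ sub] finE card_insert_if[OF finE, of "{v, u}"] by (auto split: if_splits)
    moreover have "card (edges H) < card (verts H)"
      using less.hyps H False cH by simp
    ultimately show ?thesis using cH by linarith
  qed
qed

text \<open>Growing a vertex set from \<open>{u}\<close>, each new neighbour brings at least one new
  edge. A maximal set obeying the bound is therefore closed under adjacency and contains everything
  reachable from \<open>u\<close>.\<close>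

lemma connected_card_edges:
  assumes G: "simple_graph G" and conn: "connected_graph G"
  shows "card (verts G) \<le> Suc (card (edges G))"
proof -
  obtain u where u: "u \<in> verts G" using conn by (auto simp: connected_graph_def)
  have fin: "finite (verts G)" using G by (rule simple_graph_finite)
  define good where "good S \<longleftrightarrow> u \<in> S \<and> S \<subseteq> verts G \<and> card S \<le> Suc (card (edges (induced G S)))" for S
  have "good {u}" using u by (simp add: good_def)
  moreover have "finite {S. good S}"
    by (rule finite_subset[of _ "Pow (verts G)"]) (auto simp: good_def fin)
  ultimately obtain S where S: "good S" and max: "\<And>T. good T \<Longrightarrow> S \<subseteq> T \<Longrightarrow> T = S"
    using finite_has_maximal[of "{S. good S}"] by auto
  have "verts G \<subseteq> S"
  proof
    fix w assume "w \<in> verts G"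
    then have "(adjacent G)\<^sup>*\<^sup>* u w" using conn u by (simp add: connected_graph_def)
    then show "w \<in> S"
    proof induction
      case base
      then show ?case using S by (simp add: good_def)
    next
      case (step y z)
      show ?case
      proof (rule ccontr)
        assume z: "z \<notin> S"
        have zG: "z \<in> verts G" using adjacent_verts[OF G step(2)] by simp
        have "simple_graph (induced G (insert z S))"
          using simple_graph_induced[OF G, of "insert z S"] S zG by (simp add: good_def)
        then have "finite (edges (induced G (insert z S)))" by (rule finite_edges)
        moreover have "insert {y, z} (edges (induced G S)) \<subseteq> edges (induced G (insert z S))"
          using step by (auto simp: induced_def adjacent_def)
        ultimately have "card (insert {y, z} (edges (induced G S))) \<le> card (edges (induced G (insert z S)))"
          by (rule card_mono)
        moreover have "{y, z} \<notin> edges (induced G S)" using z by (auto simp: induced_def)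
        moreover have "finite (edges (induced G S))"
          using finite_edges simple_graph_induced[OF G] S by (auto simp: good_def)
        ultimately have "Suc (card (edges (induced G S))) \<le> card (edges (induced G (insert z S)))"
          by simp
        moreover have "finite S" using S fin finite_subset by (auto simp: good_def)
        ultimately have "good (insert z S)" using S z zG by (simp add: good_def)
        then show False using max z by blast
      qed
    qed
  qed
  then have "S = verts G" using S by (auto simp: good_def)
  then show ?thesis using S by (simp add: good_def induced_verts[OF G])
qed

text \<open>Otherwise the vertices reachable from \<open>u\<close> and the remaining ones span two
  forests with no edge between them. Each has fewer edges than vertices, so at least two edges are
  missing in total.\<close>

lemma forest_connected:
  assumes G: "simple_graph G" "\<nexists>p. is_cycle G p" and E: "card (verts G) = Suc (card (edges G))"
  shows "connected_graph G"
  unfolding connected_graph_def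
proof (intro conjI ballI)
  show "verts G \<noteq> {}" using E by auto
  fix u w assume u: "u \<in> verts G" and w: "w \<in> verts G"
  have fin: "finite (verts G)" using G(1) by (rule simple_graph_finite)
  show "(adjacent G)\<^sup>*\<^sup>* u w"
  proof (rule ccontr)
    assume not: "\<not> (adjacent G)\<^sup>*\<^sup>* u w"
    define A where "A = {x \<in> verts G. (adjacent G)\<^sup>*\<^sup>* u x}"
    define B where "B = verts G - A"
    have AB: "A \<noteq> {}" "B \<noteq> {}" "A \<subseteq> verts G" "B \<subseteq> verts G" "A \<inter> B = {}" "A \<union> B = verts G"
      using u w not by (auto simp: A_def B_def)
    have lt: "card (edges (induced G S)) < card S" if "S \<subseteq> verts G" "S \<noteq> {}" for S
      using forest_card_edges[OF simple_graph_induced[OF G(1) that(1)]] G(2) that(2) is_cycle_induced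
      by auto
    have "edges G \<subseteq> edges (induced G A) \<union> edges (induced G B)"
    proof
      fix e assume e: "e \<in> edges G"
      then have "e \<subseteq> verts G" "card e = 2" using G(1) by (auto simp: simple_graph_def)
      then obtain a b where ab: "e = {a, b}" "a \<in> verts G" "b \<in> verts G" by (auto simp: card_2_iff)
      then have "adjacent G a b" "adjacent G b a" using e by (auto simp: adjacent_def insert_commute)
      then have "a \<in> A \<longleftrightarrow> b \<in> A"
        using ab by (auto simp: A_def intro: rtranclp.rtrancl_into_rtrancl)
      then show "e \<in> edges (induced G A) \<union> edges (induced G B)"
        using ab e by (auto simp: induced_def B_def)
    qed
    moreover have "finite (edges (induced G A) \<union> edges (induced G B))"
      using finite_edges simple_graph_induced[OF G(1)] AB by blast
    ultimately have "card (edges G) \<le> card (edges (induced G A)) + card (edges (induced G B))"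
      by (meson card_mono card_Un_le order_trans)
    moreover have "card (verts G) = card A + card B"
      using AB fin by (metis card_Un_disjoint finite_subset)
    ultimately show False using lt[of A] lt[of B] AB E by linarith
  qed
qed

section \<open>Graphs without short cycles\<close>

lemma successively_conv_nth:
  "successively P xs \<longleftrightarrow> (\<forall>i. Suc i < length xs \<longrightarrow> P (xs ! i) (xs ! Suc i))"
proof (induction xs rule: induct_list012)
  case (3 x y zs)
  then show ?case by (auto simp: less_Suc_eq_0_disj)
qed auto

text \<open>This form, without indices modulo the length, allows cycles to be cut and reassembled by
  appending lists.\<close>

lemma is_cycle_iff_successively:
  "is_cycle G p \<longleftrightarrow> length p \<ge> 3 \<and> distinct p \<and> successively (adjacent G) p \<and> adjacent G (last p) (hd p)"
proof -
  have "(\<forall>i<length p. adjacent G (p ! i) (p ! (Suc i mod length p)))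
      \<longleftrightarrow> successively (adjacent G) p \<and> adjacent G (last p) (hd p)" if p: "p \<noteq> []"
  proof -
    obtain m where m: "length p = Suc m" using p by (cases p) auto
    have "(\<forall>i<length p. adjacent G (p ! i) (p ! (Suc i mod length p)))
        \<longleftrightarrow> (\<forall>i<m. adjacent G (p ! i) (p ! Suc i)) \<and> adjacent G (p ! m) (p ! 0)"
      unfolding m All_less_Suc by (auto simp del: mod_Suc_eq)
    then show ?thesis
      using p by (simp add: m successively_conv_nth last_conv_nth hd_conv_nth)
  qed
  moreover have "p \<noteq> []" if "length p \<ge> 3" using that by auto
  ultimately show ?thesis unfolding is_cycle_def by blast
qed

lemma is_cycle_rotate:
  assumes "is_cycle G p" shows "is_cycle G (rotate a p)"
proof -
  have "adjacent G (rotate a p ! i) (rotate a p ! (Suc i mod length p))" if i: "i < length p" for i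
  proof -
    have "Suc i mod length p < length p" using i by (intro mod_less_divisor) auto
    then have "rotate a p ! (Suc i mod length p) = p ! (Suc ((a + i) mod length p) mod length p)"
      by (simp add: nth_rotate mod_simps)
    moreover have "(a + i) mod length p < length p" using i by (intro mod_less_divisor) auto
    ultimately show ?thesis
      using assms i by (simp add: is_cycle_def nth_rotate)
  qed
  then show ?thesis using assms by (simp add: is_cycle_def)
qed

lemma is_cycle_verts: "simple_graph G \<Longrightarrow> is_cycle G p \<Longrightarrow> set p \<subseteq> verts G"
  unfolding is_cycle_def by (metis adjacent_verts in_set_conv_nth subsetI)

text \<open>If the next vertex already lies on the path, the path is cut off there.\<close>

lemma distinct_path_of_rtranclp:
  assumes "R\<^sup>*\<^sup>* x y"
  shows "\<exists>q. q \<noteq> [] \<and> hd q = x \<and> last q = y \<and> distinct q \<and> successively R q"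
  using assms
proof induction
  case base
  show ?case by (intro exI[of _ "[x]"]) auto
next
  case (step y z)
  then obtain q where q: "q \<noteq> []" "hd q = x" "last q = y" "distinct q" "successively R q" by blast
  show ?case
  proof (cases "z \<in> set q")
    case True
    then obtain q1 q2 where q12: "q = q1 @ z # q2" by (meson split_list)
    then have "hd (q1 @ [z]) = x" using q by (cases q1) auto
    moreover have "successively R (q1 @ [z])" "distinct (q1 @ [z])"
      using q(4,5) unfolding q12 by (auto simp: successively_append_iff)
    ultimately show ?thesis by (intro exI[of _ "q1 @ [z]"]) auto
  next
    case False
    then show ?thesis
      using q step by (intro exI[of _ "q @ [z]"]) (auto simp: successively_append_iff)
  qed
qed

lemma successively_join:
  "successively R (xs @ y # ys) \<longleftrightarrow> successively R (xs @ [y]) \<and> successively R (y # ys)"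
  by (auto simp: successively_append_iff)

text \<open>An ear on a cycle of length k with s inner vertices creates two cycles of total length
  k + 2 + 2 s, which is too little for both to be long.\<close>

lemma ear_short_cycle:
  assumes G: "simple_graph G" and p: "is_cycle G (x # as @ y # bs)"
    and q: "distinct q" "set q \<inter> set (x # as @ y # bs) = {}" "successively (adjacent G) (x # q @ [y])"
    and nontriv: "q \<noteq> [] \<or> as \<noteq> [] \<and> bs \<noteq> []"
    and long: "\<And>c. is_cycle G c \<Longrightarrow> l < length c" and l: "2 * card (verts G) \<le> 3 * l"
  shows False
proof -
  note p' = p[unfolded is_cycle_iff_successively]
  have "successively (adjacent G) (rev (x # q @ [y]))"
    unfolding successively_rev using q(3) by (rule successively_mono) (auto intro: adjacent_sym)
  then have rq: "successively (adjacent G) (y # rev q @ [x])" by simp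
  \<comment> \<open>The arc through \<open>as\<close> closed by the reversed ear; \<open>c2\<close>
    is the other arc, closed by the ear.\<close>
  have c1: "is_cycle G (x # as @ y # rev q)"
    unfolding is_cycle_iff_successively
  proof (intro conjI)
    show "3 \<le> length (x # as @ y # rev q)" using nontriv by (cases q; cases as) auto
    show "distinct (x # as @ y # rev q)" using p' q by auto
    have "successively (adjacent G) ((x # as) @ [y])" "successively (adjacent G) (y # rev q)"
      using p' successively_join[of _ "x # as" y bs] rq
        successively_append_iff[of _ "y # rev q" "[x]"] by auto
    then show "successively (adjacent G) (x # as @ y # rev q)"
      using successively_join[of _ "x # as" y "rev q"] by simp
    show "adjacent G (last (x # as @ y # rev q)) (hd (x # as @ y # rev q))"
      using rq by (cases q) (auto simp: successively_append_iff successively_Cons)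
  qed
  have c2: "is_cycle G (y # bs @ x # q)"
    unfolding is_cycle_iff_successively
  proof (intro conjI)
    show "3 \<le> length (y # bs @ x # q)" using nontriv by (cases q; cases bs) auto
    show "distinct (y # bs @ x # q)" using p' q by auto
    have "successively (adjacent G) (y # bs)"
      using p' successively_join[of _ "x # as" y bs] by simp
    moreover have "adjacent G (last (y # bs)) x" using p' by simp
    ultimately have "successively (adjacent G) ((y # bs) @ [x])"
      unfolding successively_append_iff by simp
    moreover have "successively (adjacent G) (x # q)"
      using q(3) successively_append_iff[of _ "x # q" "[y]"] by simp
    ultimately show "successively (adjacent G) (y # bs @ x # q)"
      using successively_join[of _ "y # bs" x q] by simp
    show "adjacent G (last (y # bs @ x # q)) (hd (y # bs @ x # q))"
      using q(3) by (cases q) (auto simp: successively_append_iff successively_Cons)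
  qed
  have "card (set ((x # as @ y # bs) @ q)) = length ((x # as @ y # bs) @ q)"
    using p' q by (intro distinct_card) auto
  moreover have "set ((x # as @ y # bs) @ q) \<subseteq> verts G"
    using is_cycle_verts[OF G c2] is_cycle_verts[OF G p] by auto
  then have "card (set ((x # as @ y # bs) @ q)) \<le> card (verts G)"
    using G by (intro card_mono simple_graph_finite)
  \<comment> \<open>With \<open>N\<close> vertices on cycle and ear together, the lengths of the
    three cycles add up to \<open>2 * N + 2\<close>. All exceed \<open>l\<close>, so
    \<open>3 * l + 3 \<le> 2 * N + 2\<close>, while \<open>2 * N \<le> 3 * l\<close>.\<close>
  ultimately show False
    using long[OF c1] long[OF c2] long[OF p] l by simp
qed

section \<open>Chords, ears and balls around a long cycle\<close>

locale long_cycle =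
  fixes G :: "'a ugraph" and p :: "'a list" and l :: nat
  assumes G: "simple_graph G" and cycle: "is_cycle G p"
    and long: "\<And>c. is_cycle G c \<Longrightarrow> l < length c" and l: "2 * card (verts G) \<le> 3 * l"
begin

definition off :: "'a \<Rightarrow> 'a \<Rightarrow> bool" where
  "off u v \<longleftrightarrow> adjacent G u v \<and> u \<notin> set p \<and> v \<notin> set p"

text \<open>\<open>x\<close> lies in a component of the graph minus the cycle, and the vertex
  \<open>c\<close> has a neighbour in that component.\<close>

definition linked :: "'a \<Rightarrow> 'a \<Rightarrow> bool" where
  "linked c x \<longleftrightarrow> (\<exists>y. adjacent G c y \<and> y \<notin> set p \<and> off\<^sup>*\<^sup>* y x)"

text \<open>Positions on the cycle are integers read modulo its length, so both directions are
  treated alike and a stretch of the cycle is the image of an interval.\<close>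

definition P :: "int \<Rightarrow> 'a" where
  "P j = p ! nat (j mod int (length p))"

lemma length_ge_3: "length p \<ge> 3"
  using cycle by (simp add: is_cycle_def)

lemma length_pos: "length p > 0"
  using length_ge_3 by linarith

lemma mod_length_less: "nat (j mod int (length p)) < length p"
  using length_pos by (simp add: nat_less_iff)

lemma P_in: "P j \<in> set p"
  unfolding P_def using mod_length_less by (rule nth_mem)

lemma P_surj: "c \<in> set p \<Longrightarrow> \<exists>j. c = P j"
  unfolding P_def by (metis in_set_conv_nth mod_less nat_int zmod_int)

lemma P_eq_iff: "P i = P j \<longleftrightarrow> int (length p) dvd i - j"
proof -
  have pos: "int (length p) > 0" using length_pos by simp
  have "P i = P j \<longleftrightarrow> nat (i mod int (length p)) = nat (j mod int (length p))"
    using cycle mod_length_less unfolding P_def is_cycle_def by (simp add: nth_eq_iff_index_eq)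
  also have "\<dots> \<longleftrightarrow> i mod int (length p) = j mod int (length p)"
    using pos by (simp add: eq_nat_nat_iff)
  finally show ?thesis by (simp add: mod_eq_dvd_iff)
qed

lemma P_add: "P (j + int m) = p ! ((nat (j mod int (length p)) + m) mod length p)"
proof -
  have pos: "int (length p) > 0" using length_pos by simp
  have "(j + int m) mod int (length p) = (j mod int (length p) + int m) mod int (length p)"
    by (simp add: mod_simps)
  also have "\<dots> = int ((nat (j mod int (length p)) + m) mod length p)"
    using pos by (simp add: zmod_int)
  finally show ?thesis by (simp add: P_def)
qed

lemma rotate_nth_P:
  assumes "i < length p"
  shows "rotate (nat (j mod int (length p))) p ! i = P (j + int i)"
  using assms by (simp add: nth_rotate P_add)

lemma adjacent_P: "adjacent G (P j) (P (j + 1))"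
proof -
  show ?thesis
    using mod_length_less cycle P_add[of j 1] unfolding is_cycle_def by (simp add: P_def)
qed

text \<open>Brings the cycle into the shape that \<open>ear_short_cycle\<close> expects.\<close>

lemma split_at:
  assumes "d \<in> set p" "P j \<noteq> d"
  obtains as bs where "rotate (nat (j mod int (length p))) p = P j # as @ d # bs"
proof -
  let ?r = "rotate (nat (j mod int (length p))) p"
  have "?r \<noteq> []" using length_pos by auto
  moreover have "?r ! 0 = P j" using rotate_nth_P[OF length_pos] by simp
  ultimately obtain ys where ys: "?r = P j # ys" by (cases ?r) auto
  have "d \<in> set ?r" using assms by simp
  then have "d \<in> set ys" using assms ys by auto
  then show thesis using that ys by (metis split_list)
qed

text \<open>A chord is an ear without inner vertices. Hence one of the two arcs between
  \<open>P j\<close> and \<open>d\<close> has no inner vertex, and \<open>d\<close> is the next or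
  the previous vertex.\<close>

lemma no_chord:
  assumes "adjacent G (P j) d" "d \<in> set p"
  shows "d = P (j + 1) \<or> d = P (j - 1)"
proof -
  have "P j \<noteq> d" using adjacent_neq[OF G assms(1)] .
  then obtain as bs where s: "rotate (nat (j mod int (length p))) p = P j # as @ d # bs"
    using split_at assms(2) by blast
  have len: "length p = length as + length bs + 2" using arg_cong[OF s, of length] by simp
  have "is_cycle G (P j # as @ d # bs)" using is_cycle_rotate[OF cycle] s by metis
  then have "as = [] \<or> bs = []"
    using ear_short_cycle[OF G, of "P j" as d bs "[]" l] assms(1) long l by auto
  then show ?thesis
  proof
    assume "as = []"
    then have "d = rotate (nat (j mod int (length p))) p ! 1" using s by simp
    then show ?thesis using rotate_nth_P[of 1 j] length_ge_3 by simp
  next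
    assume "bs = []"
    then have "d = rotate (nat (j mod int (length p))) p ! (length p - 1)"
      using s len by (simp add: nth_append)
    also have "\<dots> = P (j + int (length p - 1))"
      using rotate_nth_P[of "length p - 1" j] length_ge_3 by simp
    also have "\<dots> = P (j - 1)"
      using length_ge_3 by (simp add: P_eq_iff)
    finally show ?thesis by simp
  qed
qed

lemma off_rtranclp_notin: "off\<^sup>*\<^sup>* y x \<Longrightarrow> y \<notin> set p \<Longrightarrow> x \<notin> set p"
  by (induction rule: rtranclp_induct) (auto simp: off_def)

text \<open>A path from \<open>P j\<close> through vertices off the cycle to a different cycle
  vertex would be an ear, so each component off the cycle is attached at one vertex at most.\<close>

lemma no_ear:
  assumes "linked (P j) x" "adjacent G x d" "d \<in> set p"
  shows "d = P j"
proof (rule ccontr)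
  assume "d \<noteq> P j"
  then obtain as bs where s: "rotate (nat (j mod int (length p))) p = P j # as @ d # bs"
    using split_at assms(3) by metis
  have sp: "set (P j # as @ d # bs) = set p" using arg_cong[OF s, of set] by simp
  have c: "is_cycle G (P j # as @ d # bs)" using is_cycle_rotate[OF cycle] s by metis
  obtain y where y: "adjacent G (P j) y" "y \<notin> set p" "off\<^sup>*\<^sup>* y x"
    using assms(1) by (auto simp: linked_def)
  obtain q where q: "q \<noteq> []" "hd q = y" "last q = x" "distinct q" "successively off q"
    using distinct_path_of_rtranclp[OF y(3)] by blast
  have "z \<notin> set p" if "z \<in> set q" for z
    using q(5) q(2) y(2) that
    by (induction q arbitrary: y rule: induct_list012) (auto simp: off_def)
  then have "set q \<inter> set (P j # as @ d # bs) = {}" unfolding sp by blast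
  moreover have "successively (adjacent G) q"
    using q(5) by (rule successively_mono) (simp add: off_def)
  then have "successively (adjacent G) (P j # q @ [d])"
    using q y(1) assms(2) by (auto simp: successively_append_iff successively_Cons)
  ultimately show False
    using ear_short_cycle[OF G c q(4)] q(1) long l by blast
qed

text \<open>Each vertex gets an anchor \<open>j\<close>: its own position on the cycle or that of
  the vertex its component hangs on. By \<open>no_chord\<close> and \<open>no_ear\<close> an edge
  shifts the anchor by at most one, and only when it runs along the cycle.\<close>

lemma ball_on_cycle_from:
  assumes v: "v = P a \<or> linked (P a) v" and x: "x \<in> ball G v i"
  shows "\<exists>j. \<bar>j - a\<bar> \<le> int i \<and> (x = P j \<or> linked (P j) x)"
  using x
proof (induction i arbitrary: x)
  case 0
  then show ?case using v by (intro exI[of _ a]) auto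
next
  case (Suc i)
  show ?case
  proof (cases "x \<in> ball G v i")
    case True
    then show ?thesis using Suc.IH by force
  next
    case False
    then obtain u where u: "u \<in> ball G v i" "adjacent G u x" using Suc.prems by auto
    obtain j where j: "\<bar>j - a\<bar> \<le> int i" "u = P j \<or> linked (P j) u" using Suc.IH[OF u(1)] by blast
    consider "u = P j" "x \<in> set p" | "u = P j" "x \<notin> set p"
      | "linked (P j) u" "x \<in> set p" | "linked (P j) u" "x \<notin> set p" using j by blast
    then show ?thesis
    proof cases
      case 1
      then have "x = P (j + 1) \<or> x = P (j - 1)" using no_chord u by blast
      moreover have "\<bar>j + 1 - a\<bar> \<le> int (Suc i)" "\<bar>j - 1 - a\<bar> \<le> int (Suc i)" using j by auto
      ultimately show ?thesis by blast
    next
      case 2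
      then have "linked (P j) x" using u by (auto simp: linked_def)
      then show ?thesis using j by force
    next
      case 3
      then have "x = P j" using no_ear u by blast
      then show ?thesis using j by force
    next
      case 4
      then obtain y where y: "adjacent G (P j) y" "y \<notin> set p" "off\<^sup>*\<^sup>* y u"
        by (auto simp: linked_def)
      then have "off u x" using off_rtranclp_notin 4 u by (simp add: off_def)
      then have "linked (P j) x"
        using y unfolding linked_def by (meson rtranclp.rtrancl_into_rtrancl)
      then show ?thesis using j by force
    qed
  qed
qed

lemma ball_off_cycle:
  assumes v: "v \<notin> set p" and no: "\<And>c. c \<in> set p \<Longrightarrow> \<not> linked c v" and x: "x \<in> ball G v i"
  shows "off\<^sup>*\<^sup>* v x"
  using x
proof (induction i arbitrary: x)
  case (Suc i)
  show ?case
  proof (cases "x \<in> ball G v i")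
    case False
    then obtain u where u: "u \<in> ball G v i" "adjacent G u x" using Suc.prems by auto
    have vu: "off\<^sup>*\<^sup>* v u" using Suc.IH[OF u(1)] .
    then have up: "u \<notin> set p" using off_rtranclp_notin v by blast
    have "symp off" by (auto simp: symp_def off_def adjacent_sym)
    \<comment> \<open>Reversed, the path leads from a supposed cycle neighbour \<open>x\<close> of
      \<open>u\<close> to \<open>v\<close>, which would make \<open>v\<close> linked to
      \<open>x\<close>.\<close>
    then have "off\<^sup>*\<^sup>* u v" using vu by (meson symp_rtranclp sympD)
    then have "x \<notin> set p" using no up u(2) adjacent_sym unfolding linked_def by meson
    then show ?thesis using vu up u(2) by (meson off_def rtranclp.rtrancl_into_rtrancl)
  qed (rule Suc.IH)
qed simp

text \<open>A cycle vertex is its own anchor, and the anchors fill an interval of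
  \<open>2 * r + 1\<close> integers. A centre that is neither on the cycle nor linked to it never
  reaches the cycle.\<close>

lemma card_ball_Int_cycle: "card (ball G v r \<inter> set p) \<le> 2 * r + 1"
proof -
  have "\<exists>a. ball G v r \<inter> set p \<subseteq> P ` {a - int r..a + int r}"
  proof (cases "\<exists>a. v = P a \<or> linked (P a) v")
    case True
    then obtain a where a: "v = P a \<or> linked (P a) v" by blast
    have "x \<in> P ` {a - int r..a + int r}" if x: "x \<in> ball G v r" "x \<in> set p" for x
    proof -
      obtain j where j: "\<bar>j - a\<bar> \<le> int r" "x = P j \<or> linked (P j) x"
        using ball_on_cycle_from[OF a x(1)] by blast
      have "\<not> linked (P j) x" using x(2) off_rtranclp_notin by (auto simp: linked_def)
      then have "x = P j" "j \<in> {a - int r..a + int r}" using j by auto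
      then show ?thesis by blast
    qed
    then show ?thesis by blast
  next
    case False
    then have "v \<notin> set p" "\<And>c. c \<in> set p \<Longrightarrow> \<not> linked c v" using P_surj by metis+
    then have "ball G v r \<inter> set p = {}" using ball_off_cycle off_rtranclp_notin by blast
    then show ?thesis by simp
  qed
  then obtain a where "ball G v r \<inter> set p \<subseteq> P ` {a - int r..a + int r}" by blast
  then have "card (ball G v r \<inter> set p) \<le> card (P ` {a - int r..a + int r})"
    by (intro card_mono) auto
  also have "\<dots> \<le> card {a - int r..a + int r}" by (rule card_image_le) simp
  finally show ?thesis by simp
qed

lemma card_ball:
  assumes "v \<in> verts G"
  shows "card (ball G v r) + length p \<le> 2 * r + 1 + card (verts G)"
proof -
  have fin: "finite (verts G)" using G by (rule simple_graph_finite)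
  have sub: "ball G v r \<subseteq> verts G" using G assms by (rule ball_subset_verts)
  have p: "set p \<subseteq> verts G" "card (set p) = length p"
    using is_cycle_verts[OF G cycle] cycle distinct_card by (auto simp: is_cycle_def)
  have "card (ball G v r) \<le> card (ball G v r \<inter> set p) + card (verts G - set p)"
    using fin sub by (intro order_trans[OF card_mono card_Un_le]) auto
  moreover have "card (verts G - set p) + length p = card (verts G)"
    using p fin card_Diff_subset[of "set p" "verts G"] card_mono[OF fin p(1)] by simp
  ultimately show ?thesis using card_ball_Int_cycle[of v r] by linarith
qed

text \<open>The arms run around the cycle in opposite directions, possibly several times. Length at
  least 3 gives \<open>P (j + 2) \<noteq> P j\<close>, which prevents backtracking and separates the
  first steps.\<close>

lemma cycle_vertex_middle:
  assumes "c \<in> set p" shows "middle G r c"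
proof -
  obtain a where a: "c = P a" using P_surj assms by blast
  have verts: "P j \<in> verts G" for j using P_in is_cycle_verts[OF G cycle] by blast
  have neq: "P (j + 2) \<noteq> P j" for j
    using length_ge_3 zdvd_imp_le[of "int (length p)" 2] by (auto simp: P_eq_iff)
  have "nb_walk G (\<lambda>i. P (a + int i)) r"
    unfolding nb_walk_def
  proof (intro conjI allI impI)
    show "adjacent G (P (a + int i)) (P (a + int (Suc i)))" for i
      using adjacent_P[of "a + int i"] by (simp add: add_ac)
    show "P (a + int i) \<noteq> P (a + int (Suc (Suc i)))" for i
      using neq[of "a + int i"] by (simp add: add_ac)
  qed (rule verts)
  moreover have "nb_walk G (\<lambda>i. P (a - int i)) r"
    unfolding nb_walk_def
  proof (intro conjI allI impI)
    show "adjacent G (P (a - int i)) (P (a - int (Suc i)))" for i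
      using adjacent_sym[OF adjacent_P[of "a - int (Suc i)"]] by simp
    show "P (a - int i) \<noteq> P (a - int (Suc (Suc i)))" for i
      using neq[of "a - int (Suc (Suc i))"] by (simp add: add_ac)
  qed (rule verts)
  moreover have "P (a + 1) \<noteq> P (a - 1)" using neq[of "a - 1"] by (simp add: add.commute)
  ultimately show ?thesis
    unfolding middle_def a
    by (intro exI[of _ "\<lambda>i. P (a + int i)"] exI[of _ "\<lambda>i. P (a - int i)"]) simp
qed

lemma length_le_card_middle: "length p \<le> card {v. middle G r v}"
proof -
  have "length p = card (set p)" using cycle by (simp add: is_cycle_def distinct_card)
  also have "\<dots> \<le> card {v. middle G r v}"
    using cycle_vertex_middle middle_in_verts simple_graph_finite[OF G]
    by (intro card_mono finite_subset[of "{v. middle G r v}" "verts G"]) auto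
  finally show ?thesis .
qed

end

section \<open>Recognising trees\<close>

lemma is_cycle_map:
  assumes f: "bij_betw f (verts H) (verts K)" and H: "simple_graph H"
    and adj: "\<forall>u\<in>verts H. \<forall>v\<in>verts H. adjacent H u v \<longleftrightarrow> adjacent K (f u) (f v)"
    and p: "is_cycle H p"
  shows "is_cycle K (map f p)"
proof -
  have sub: "set p \<subseteq> verts H" using H p by (rule is_cycle_verts)
  have "distinct (map f p)"
    using p f sub by (auto simp: is_cycle_def distinct_map bij_betw_def intro: inj_on_subset)
  moreover have "adjacent K (f (p ! i)) (f (p ! (Suc i mod length p)))" if i: "i < length p" for i
  proof -
    have "Suc i mod length p < length p" using i by (intro mod_less_divisor) auto
    then have "p ! i \<in> verts H" "p ! (Suc i mod length p) \<in> verts H" using sub i by auto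
    moreover have "adjacent H (p ! i) (p ! (Suc i mod length p))" using p i by (simp add: is_cycle_def)
    ultimately show ?thesis using adj by blast
  qed
  moreover have "Suc i mod length p < length p" if "i < length p" for i
    using that by (intro mod_less_divisor) auto
  ultimately show ?thesis using p by (simp add: is_cycle_def)
qed

text \<open>A cycle with at most \<open>l\<close> vertices extends to an \<open>l\<close>-set of
  vertices; the resulting card would put a cycle into \<open>G\<close>.\<close>

lemma deck_eq_long_cycles:
  assumes G: "simple_graph G" "simple_graph G'"
    and deck: "deck l G = deck l G'" and l: "l \<le> card (verts G')"
    and acyclic: "\<nexists>p. is_cycle G p" and p: "is_cycle G' p"
  shows "l < length p"
proof (rule ccontr)
  assume "\<not> l < length p"
  moreover have "card (set p) = length p" using p by (simp add: is_cycle_def distinct_card)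
  ultimately obtain S where S: "set p \<subseteq> S" "S \<subseteq> verts G'" "card S = l"
    using exists_subset_between[of "set p" l "verts G'"] l is_cycle_verts[OF G(2) p]
      simple_graph_finite[OF G(2)] by auto
  obtain S' where "isomorphic (induced G' S) (induced G S')"
    using deck_eq_card[OF G(2,1) deck[symmetric] S(2,3)] by blast
  then obtain f where f: "bij_betw f (verts (induced G' S)) (verts (induced G S'))"
    "\<forall>u\<in>verts (induced G' S). \<forall>v\<in>verts (induced G' S).
       adjacent (induced G' S) u v \<longleftrightarrow> adjacent (induced G S') (f u) (f v)"
    unfolding isomorphic_def by blast
  have "is_cycle (induced G' S) p"
    using p S(1) unfolding is_cycle_def by (auto intro!: nth_mem mod_less_divisor subsetD[OF S(1)])
  from is_cycle_map[OF f(1) simple_graph_induced[OF G(2) S(2)] f(2) this]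
  show False using acyclic is_cycle_induced by blast
qed

text \<open>The card from \<open>large_ball_induced\<close> has radius at most \<open>r\<close>
  about \<open>v\<close>, and so does its copy in \<open>G'\<close>, which therefore lies in a ball
  of \<open>G'\<close> with at least \<open>l\<close> vertices.\<close>

lemma deck_eq_small_balls:
  assumes G: "simple_graph G" "simple_graph G'"
    and deck: "deck l G = deck l G'" and l: "1 \<le> l"
    and small: "\<And>v. v \<in> verts G' \<Longrightarrow> card (ball G' v r) < l" and v: "v \<in> verts G"
  shows "card (ball G v r) < l"
proof (rule ccontr)
  assume "\<not> card (ball G v r) < l"
  have sub: "ball G v r \<subseteq> verts G" using G(1) v by (rule ball_subset_verts)
  have "finite (ball G v r)" using sub simple_graph_finite[OF G(1)] by (rule finite_subset)
  then obtain S where S: "v \<in> S" "S \<subseteq> ball (induced G S) v r" "S \<subseteq> verts G" "card S = l"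
    using large_ball_induced[of G v r l] l \<open>\<not> card (ball G v r) < l\<close> sub by auto
  obtain S' where S': "S' \<subseteq> verts G'" "card S' = l" "isomorphic (induced G S) (induced G' S')"
    using deck_eq_card[OF G deck S(3,4)] by blast
  then obtain f where f: "bij_betw f (verts (induced G S)) (verts (induced G' S'))"
    "\<forall>u\<in>verts (induced G S). \<forall>v\<in>verts (induced G S).
       adjacent (induced G S) u v \<longleftrightarrow> adjacent (induced G' S') (f u) (f v)"
    unfolding isomorphic_def by blast
  have "S' = f ` S" using f(1) by (simp add: bij_betw_def)
  also have "\<dots> \<subseteq> f ` ball (induced G S) v r" using S(2) by blast
  also have "\<dots> \<subseteq> ball (induced G' S') (f v) r"
    using ball_isomorphic[OF f(1) simple_graph_induced[OF G(1) S(3)] f(2)] S(1) by simp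
  also have "\<dots> \<subseteq> ball G' (f v) r" by (rule ball_induced_subset)
  finally have "S' \<subseteq> ball G' (f v) r" .
  moreover have fv: "f v \<in> verts G'" using \<open>S' = f ` S\<close> S(1) S'(1) by blast
  then have "finite (ball G' (f v) r)"
    using ball_subset_verts[OF G(2)] simple_graph_finite[OF G(2)] finite_subset by metis
  ultimately have "l \<le> card (ball G' (f v) r)" using S'(2) card_mono by metis
  then show False using small[OF fv] by simp
qed

lemma deck_eq_forest:
  fixes G G' :: "'a ugraph"
  assumes graphs: "simple_graph G" "simple_graph G'" "card (verts G) = card (verts G')"
    and deck: "deck l G = deck l G'"
    and bound: "2 * card (verts G) + 4 \<le> 3 * l" "l \<le> card (verts G)"
    and acyclic: "\<nexists>p. is_cycle G p"
  shows "\<nexists>p. is_cycle G' p"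
proof
  assume "\<exists>p. is_cycle G' p"
  then obtain p where p: "is_cycle G' p" by blast
  interpret long_cycle G' p l
    using graphs(2,3) p bound deck_eq_long_cycles[OF graphs(1,2) deck _ acyclic] by unfold_locales auto
  let ?n = "card (verts G)"
  \<comment> \<open>The least \<open>r\<close> with \<open>2 * r > ?n - length p\<close>: large
    enough to leave fewer than \<open>length p\<close> middle vertices in the forest, and small
    enough to keep the balls of \<open>G'\<close> below \<open>l\<close>.\<close>
  define r where "r = (?n - length p) div 2 + 1"
  have k: "l < length p" "length p \<le> ?n"
    using long[OF p] is_cycle_verts[OF graphs(2) p] simple_graph_finite[OF graphs(2)] p graphs(3) card_mono
    by (auto simp: is_cycle_def simp flip: distinct_card)
  then have "?n < length p + 2 * r" "2 * r \<le> ?n - length p + 2" "r \<ge> 1"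
    using div_mult_mod_eq[of "?n - length p" 2] mod_less_divisor[of 2 "?n - length p"] r_def
    by simp_all
  note r = this
  \<comment> \<open>With \<open>k = length p \<ge> l + 1\<close>, the ball has at most \<open>2 * r
    + 1 + n - k \<le> 2 * (n - k) + 3 \<le> 2 * n - 2 * l + 1 \<le> l - 3\<close> vertices, where
    \<open>n\<close> stands for \<open>?n\<close>.\<close>
  have ball': "card (ball G' v r) < l" if "v \<in> verts G'" for v
    using card_ball[OF that, of r] r k bound(1) graphs(3) by linarith
  have "1 \<le> l" using bound(1) by linarith
  note ball = deck_eq_small_balls[OF graphs(1,2) deck this ball']
  have eq: "card {v. middle G r v} = card {v. middle G' r v}"
    using deck_eq_card_middle[OF r(3) graphs deck bound(2)] ball ball' by (simp add: less_imp_le)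
  then have big: "length p \<le> card {v. middle G r v}"
    using length_le_card_middle by simp
  \<comment> \<open>\<open>card_middle_forest\<close> needs one middle vertex of \<open>G\<close>;
    the equal counts supply it.\<close>
  then have "card {v. middle G r v} \<noteq> 0" using k(1) by linarith
  then obtain v where "middle G r v" by force
  then have "card {v. middle G r v} + 2 * r \<le> ?n"
    by (rule card_middle_forest[OF graphs(1) acyclic])
  then show False using big r(1) by linarith
qed

text \<open>Acyclicity passes over by \<open>deck_eq_forest\<close> and the number of edges by
  Kelly's lemma; a forest with one edge fewer than vertices is connected.\<close>

lemma deck_eq_tree:
  fixes G G' :: "'a ugraph"
  assumes G: "simple_graph G" "simple_graph G'" "card (verts G) = card (verts G')"
    and deck: "deck l G = deck l G'"
    and l: "2 * card (verts G) + 4 \<le> 3 * l" "l \<le> card (verts G)"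
    and tree: "is_tree G"
  shows "is_tree G'"
proof -
  have conn: "connected_graph G" and acyclic: "\<nexists>p. is_cycle G p"
    using tree by (auto simp: is_tree_def)
  have acyclic': "\<nexists>p. is_cycle G' p"
    using deck_eq_forest[OF G deck l acyclic] .
  have "verts G \<noteq> {}" using conn by (simp add: connected_graph_def)
  then have "card (verts G) = Suc (card (edges G))"
    using forest_card_edges[OF G(1) acyclic] connected_card_edges[OF G(1) conn] by linarith
  also have "card (edges G) = card (edges G')"
    using deck_eq_card_edges[OF G deck _ l(2)] l(1) by linarith
  finally have "connected_graph G'"
    using forest_connected[OF G(2) acyclic'] G(3) by simp
  then show ?thesis using acyclic' by (simp add: is_tree_def)
qed

theorem theorem1p6:
  fixes G G' :: "'a ugraph" and n l :: nat
  assumes "n \<ge> 1"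
    and "(2 * real n + 4) / 3 \<le> real l" and "l \<le> n"
    and "simple_graph G" and "card (verts G) = n"
    and "simple_graph G'" and "card (verts G') = n"
    and "deck l G = deck l G'"
  shows "is_tree G \<longleftrightarrow> is_tree G'"
proof -
  have "real (2 * n + 4) \<le> real (3 * l)" using assms(2) by simp
  then have "2 * n + 4 \<le> 3 * l" by (simp only: of_nat_le_iff)
  then have l: "2 * card (verts G) + 4 \<le> 3 * l" "l \<le> card (verts G)"
    "2 * card (verts G') + 4 \<le> 3 * l" "l \<le> card (verts G')"
    using assms(3,5,7) by simp_all
  have eq: "card (verts G) = card (verts G')" using assms(5,7) by simp
  show ?thesis
    using deck_eq_tree[OF assms(4,6) eq assms(8) l(1,2)]
      deck_eq_tree[OF assms(6,4) eq[symmetric] assms(8)[symmetric] l(3,4)] by blast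
qed

end
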